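(* For every integer $d\ge 0$ there exists a constant $L_d\in(0,\infty)$, depending only on $d$, such that the following holds. Let $n\ge1$ and, for $j=0,1,\dots,d$, let $(a^{j}_{i_1,\dots,i_j})_{1\le i_1,\dots,i_j\le n}$ be a $j$-indexed symmetric array of real numbers (or, more generally, of elements of some normed space $E$) such that $a^j_{i_1,\dots,i_j}=0$ whenever $i_k=i_l$ for some $1\le k<l\le j$ (for $j=0$ this is a single element $a^0_\emptyset$). Let $X_1,\dots,X_n$ be independent mean zero real random variables. Then for all $p\ge 1$, $$\sum_{j=0}^d\Big\|\sum_{i_1,\dots,i_j=1}^n a^j_{i_1,\dots,i_j}X_{i_1}\cdots X_{i_j}\Big\|_p\ \le\ L_d\Big\|\sum_{j=0}^d\sum_{i_1,\dots,i_j=1}^n a^j_{i_1,\dots,i_j}X_{i_1}\cdots X_{i_j}\Big\|_p .$$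
   Context: For a random variable $Y$ with values in $\mathbb R$ (resp. in a normed space $(E,\|\cdot\|)$), $\|Y\|_p=(\mathbb E|Y|^p)^{1/p}$ (resp. $(\mathbb E\|Y\|^p)^{1/p}$), possibly $+\infty$. An array is symmetric if it is invariant under permutations of its indices. The $j=0$ term is the constant $a^0_\emptyset$. *)

theory Defs
  imports "HOL-Probability.Probability" "HOL-Combinatorics.Permutations"
    "HOL-Analysis.Bounded_Continuous_Function"
begin

text \<open>
  The norm \<open>\<parallel>Y\<parallel>\<^sub>p\<close> takes the value \<open>\<infinity>\<close> when \<open>\<E> \<parallel>Y\<parallel>\<^sup>p\<close> is infinite. There is no real power
  on \<^typ>\<open>ennreal\<close>, hence the case distinction.
\<close>

definition Lp_norm :: "'a measure \<Rightarrow> real \<Rightarrow> ('a \<Rightarrow> 'e::real_normed_vector) \<Rightarrow> ennreal" where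
  "Lp_norm M p Y =
     (let I = (\<integral>\<^sup>+ \<omega>. ennreal (norm (Y \<omega>) powr p) \<partial>M)
      in if I = \<infinity> then \<infinity> else ennreal (enn2real I powr (1 / p)))"

text \<open>
  A multi-index \<open>(i\<^sub>1, \<dots>, i\<^sub>j)\<close> is the list \<open>[i\<^sub>1, \<dots>, i\<^sub>j]\<close>; for \<open>j = 0\<close> there is exactly one, the
  empty list. A \<open>j\<close>-indexed array is a function on lists, of which only the values on
  \<open>multi_indices n j\<close> matter.
\<close>

definition multi_indices :: "nat \<Rightarrow> nat \<Rightarrow> nat list set" where
  "multi_indices n j = {is. length is = j \<and> set is \<subseteq> {1..n}}"

definition symmetric_array :: "nat \<Rightarrow> nat \<Rightarrow> (nat list \<Rightarrow> 'e) \<Rightarrow> bool" where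
  "symmetric_array n j a \<longleftrightarrow>
     (\<forall>is \<in> multi_indices n j. \<forall>\<pi>. \<pi> permutes {..<j} \<longrightarrow> a (permute_list \<pi> is) = a is)"

definition vanishes_on_diagonals :: "nat \<Rightarrow> nat \<Rightarrow> (nat list \<Rightarrow> 'e::zero) \<Rightarrow> bool" where
  "vanishes_on_diagonals n j a \<longleftrightarrow>
     (\<forall>is \<in> multi_indices n j. (\<exists>k l. k < l \<and> l < j \<and> is ! k = is ! l) \<longrightarrow> a is = 0)"

definition homogeneous_chaos ::
  "nat \<Rightarrow> nat \<Rightarrow> (nat list \<Rightarrow> 'e::real_normed_vector) \<Rightarrow> (nat \<Rightarrow> 'a \<Rightarrow> real) \<Rightarrow> 'a \<Rightarrow> 'e" where
  "homogeneous_chaos n j a X \<omega> =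
     (\<Sum>is \<in> multi_indices n j. prod_list (map (\<lambda>i. X i \<omega>) is) *\<^sub>R a is)"

text \<open>
  The constant \<open>L\<close> is valid in degree \<open>d\<close> for all random variables on probability spaces over
  \<^typ>\<open>'a\<close> and all coefficients in the normed space \<^typ>\<open>'e\<close>.
\<close>

definition valid_constant ::
  "'a itself \<Rightarrow> 'e::real_normed_vector itself \<Rightarrow> nat \<Rightarrow> real \<Rightarrow> bool" where
  "valid_constant ta te d L \<longleftrightarrow>
     (\<forall>n\<ge>1. \<forall>(a :: nat \<Rightarrow> nat list \<Rightarrow> 'e) (M :: 'a measure) (X :: nat \<Rightarrow> 'a \<Rightarrow> real) (p::real).
        (\<forall>j\<le>d. symmetric_array n j (a j) \<and> vanishes_on_diagonals n j (a j)) \<longrightarrow>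
        prob_space M \<longrightarrow>
        prob_space.indep_vars M (\<lambda>_. borel) X {1..n} \<longrightarrow>
        (\<forall>i\<in>{1..n}. integrable M (X i) \<and> (\<integral>\<omega>. X i \<omega> \<partial>M) = 0) \<longrightarrow>
        p \<ge> 1 \<longrightarrow>
        (\<Sum>j\<le>d. Lp_norm M p (homogeneous_chaos n j (a j) X))
          \<le> ennreal L * Lp_norm M p (\<lambda>\<omega>. \<Sum>j\<le>d. homogeneous_chaos n j (a j) X \<omega>))"

text \<open>
  HOL cannot quantify over types below an existential quantifier, so a statement
  \<open>\<exists>L. valid_constant TYPE('a) TYPE('e) d L\<close> would let \<open>L\<close> depend on the normed space \<^typ>\<open>'e\<close> and
  on the sample space \<^typ>\<open>'a\<close>. To express that \<open>L\<close> depends on \<open>d\<close> only, one asks for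
  an \<open>L\<close> that is valid for one fixed closed pair of types, and that validity for this
  pair entails validity for every pair. The pair below is suitable since \<open>X\<^sub>1, \<dots>, X\<^sub>n\<close> have a joint
  law on sequences and \<open>\<ell>\<^sup>\<infinity>\<close>, i.e. \<^typ>\<open>nat \<Rightarrow>\<^sub>C real\<close>, contains every finite-dimensional normed
  space isometrically.
\<close>

abbreviation valid_constant_universal :: "nat \<Rightarrow> real \<Rightarrow> bool" where
  "valid_constant_universal \<equiv> valid_constant TYPE(nat \<Rightarrow> real) TYPE(nat \<Rightarrow>\<^sub>C real)"

end

theory Submission
  imports Defs
begin

text \<open>
  The argument rests on dilations. The chaos \<open>Q\<^sub>0 + \<dots> + Q\<^sub>d\<close> is a polynomial \<open>F\<close> in the independent
  centred variables \<open>X\<^sub>1, \<dots>, X\<^sub>n\<close>, and it is affine in each of them because the coefficients vanish on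
  diagonals. For fixed values of the other variables, the \<open>p\<close>-th power of the norm is a convex function
  of \<open>X\<^sub>i\<close>, so that by Jensen's inequality its expectation does not increase when \<open>X\<^sub>i\<close> is replaced by
  \<open>c X\<^sub>i\<close> with \<open>0 \<le> c \<le> 1\<close>. Doing this for all \<open>i\<close> yields \<open>Lp_norm_dilated_chaos_le\<close>:
  the \<open>L\<^sup>p\<close>-norm of \<open>c\<^sup>0 Q\<^sub>0 + \<dots> + c\<^sup>d Q\<^sub>d\<close> is at most that of \<open>Q\<^sub>0 + \<dots> + Q\<^sub>d\<close>.

  The case \<open>c = 1 / 2\<close> is enough to separate the components: subtracting the chaos from \<open>2\<^sup>d\<close> times its
  dilation removes the component of degree \<open>d\<close> and multiplies the other ones by factors of at least
  \<open>1\<close>, so that induction on the degree applies (\<open>Lp_norm_components_le\<close>). The resulting constant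
  depends on \<open>d\<close> only and is the same for all sample spaces and all normed spaces.

  For the second half of the theorem a constant that is valid for real sequences as sample space and
  \<open>\<ell>\<^sup>\<infinity>\<close> as coefficient space has to be carried over, unchanged, to arbitrary types
  (\<open>valid_constant_from_universal\<close>). The joint law of the variables is realised on the
  sequences, and the span of the coefficients is embedded isometrically into \<open>\<ell>\<^sup>\<infinity>\<close> by means of
  norming functionals at the points of a countable dense subset.
\<close>

section \<open>\<open>L\<^sup>p\<close>-norms of vector-valued functions\<close>

lemma norm_powr_convex:
  fixes x y :: "'e::real_normed_vector"
  assumes p: "p \<ge> 1" and c: "0 \<le> c" "c \<le> 1"
  shows "norm ((1 - c) *\<^sub>R x + c *\<^sub>R y) powr p \<le> (1 - c) * norm x powr p + c * norm y powr p"
proof -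
  have powr: "((1 - c) * a + c * b) powr p \<le> (1 - c) * a powr p + c * b powr p"
    if ab: "0 \<le> a" "0 \<le> b" for a b :: real
  proof -
    have shrink: "(t * s) powr p \<le> t * s powr p" if "0 \<le> t" "t \<le> 1" "0 \<le> s" for t s :: real
    proof -
      have "t powr p \<le> t"
        using that p powr_mono'[of 1 p t] by (cases "t = 0") auto
      then show ?thesis
        using that by (simp add: powr_mult mult_right_mono)
    qed
    \<comment> \<open>\<open>powr_convex\<close> covers the open half-line; the endpoint \<open>0\<close> follows from \<open>t powr p \<le> t\<close>.\<close>
    show ?thesis
    proof (cases "a = 0 \<or> b = 0")
      case True
      then show ?thesis
        using shrink[of c b] shrink[of "1 - c" a] ab c p by auto
    next
      case False
      then show ?thesis
        using convex_onD[OF powr_convex[OF p], of c a b] ab c by auto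
    qed
  qed
  have "norm ((1 - c) *\<^sub>R x + c *\<^sub>R y) \<le> (1 - c) * norm x + c * norm y"
    using norm_triangle_ineq[of "(1 - c) *\<^sub>R x" "c *\<^sub>R y"] c by simp
  then have "norm ((1 - c) *\<^sub>R x + c *\<^sub>R y) powr p \<le> ((1 - c) * norm x + c * norm y) powr p"
    using p by (intro powr_mono2) auto
  also have "\<dots> \<le> (1 - c) * norm x powr p + c * norm y powr p"
    by (rule powr) auto
  finally show ?thesis .
qed

text \<open>
  Bounds on \<open>Lp_norm\<close> by positive reals are bounds on the integral of the \<open>p\<close>-th power. Combined
  with \<open>ennreal_le_if_real_bounds_le\<close> below, this reduces inequalities between norms to finite bounds, without
  a separate look at the value \<open>\<infinity>\<close>.
\<close>

lemma Lp_norm_le_iff: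
  assumes p: "p > 0" and r: "r > 0"
  shows "Lp_norm M p Y \<le> ennreal r \<longleftrightarrow>
           (\<integral>\<^sup>+ \<omega>. ennreal (norm (Y \<omega>) powr p) \<partial>M) \<le> ennreal (r powr p)"
proof (cases "(\<integral>\<^sup>+ \<omega>. ennreal (norm (Y \<omega>) powr p) \<partial>M)" rule: ennreal_cases)
  case (real s)
  have "s powr (1 / p) \<le> r \<longleftrightarrow> s \<le> r powr p"
  proof
    assume "s powr (1 / p) \<le> r"
    then have "(s powr (1 / p)) powr p \<le> r powr p"
      using p by (intro powr_mono2) auto
    then show "s \<le> r powr p"
      using real p by (simp add: powr_powr)
  next
    assume "s \<le> r powr p"
    then have "s powr (1 / p) \<le> (r powr p) powr (1 / p)"
      using p real by (intro powr_mono2) auto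
    then show "s powr (1 / p) \<le> r"
      using r p by (simp add: powr_powr)
  qed
  then show ?thesis
    using real r by (simp add: Lp_norm_def)
next
  case top
  then show ?thesis by (simp add: Lp_norm_def top_unique)
qed

lemma ennreal_le_if_real_bounds_le:
  fixes x y :: ennreal
  assumes "\<And>r. 0 < r \<Longrightarrow> y \<le> ennreal r \<Longrightarrow> x \<le> ennreal r"
  shows "x \<le> y"
proof (rule ennreal_le_epsilon)
  fix e :: real assume y: "y < top" and e: "0 < e"
  then have "y + ennreal e = ennreal (enn2real y + e)"
    by (simp add: ennreal_enn2real)
  moreover have "y \<le> y + ennreal e" by simp
  ultimately show "x \<le> y + ennreal e"
    using assms[of "enn2real y + e"] e by (simp add: add_nonneg_pos)
qed

lemma Lp_norm_mono:
  assumes "p > 0"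
    and "(\<integral>\<^sup>+ \<omega>. ennreal (norm (Y \<omega>) powr p) \<partial>M) \<le> (\<integral>\<^sup>+ \<omega>. ennreal (norm (Z \<omega>) powr p) \<partial>N)"
  shows "Lp_norm M p Y \<le> Lp_norm N p Z"
proof (rule ennreal_le_if_real_bounds_le)
  fix r :: real assume "0 < r" "Lp_norm N p Z \<le> ennreal r"
  then show "Lp_norm M p Y \<le> ennreal r"
    using assms order_trans[OF assms(2)] by (simp add: Lp_norm_le_iff)
qed

lemma Lp_norm_mono_pointwise:
  assumes "p > 0" and "\<And>\<omega>. norm (Y \<omega>) \<le> norm (Z \<omega>)"
  shows "Lp_norm M p Y \<le> Lp_norm M p Z"
  using assms by (intro Lp_norm_mono nn_integral_mono) (simp_all add: ennreal_leI powr_mono2)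

lemma Lp_norm_scaleR_le:
  fixes Y :: "'a \<Rightarrow> 'e::real_normed_vector"
  assumes p: "p > 0" and Y: "Y \<in> borel_measurable M"
  shows "Lp_norm M p (\<lambda>\<omega>. c *\<^sub>R Y \<omega>) \<le> ennreal \<bar>c\<bar> * Lp_norm M p Y"
proof (cases "c = 0")
  case True
  then show ?thesis using p by (simp add: Lp_norm_def)
next
  case False
  have meas: "(\<lambda>\<omega>. norm (Y \<omega>)) \<in> borel_measurable M"
    using Y by simp
  show ?thesis
  proof (rule ennreal_le_if_real_bounds_le)
    fix r :: real assume r: "0 < r" and le: "ennreal \<bar>c\<bar> * Lp_norm M p Y \<le> ennreal r"
    have "ennreal \<bar>c\<bar> * Lp_norm M p Y \<le> ennreal \<bar>c\<bar> * ennreal (r / \<bar>c\<bar>)"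
      using le False r by (simp flip: ennreal_mult)
    then have "Lp_norm M p Y \<le> ennreal (r / \<bar>c\<bar>)"
      using False by (subst (asm) ennreal_mult_le_mult_iff) auto
    then have int: "(\<integral>\<^sup>+ \<omega>. ennreal (norm (Y \<omega>) powr p) \<partial>M) \<le> ennreal ((r / \<bar>c\<bar>) powr p)"
      using r False p by (simp add: Lp_norm_le_iff)
    have "(\<integral>\<^sup>+ \<omega>. ennreal (norm (c *\<^sub>R Y \<omega>) powr p) \<partial>M)
        = ennreal (\<bar>c\<bar> powr p) * (\<integral>\<^sup>+ \<omega>. ennreal (norm (Y \<omega>) powr p) \<partial>M)"
      using meas by (subst nn_integral_cmult[symmetric]) (auto simp: powr_mult ennreal_mult)
    also have "\<dots> \<le> ennreal (\<bar>c\<bar> powr p) * ennreal ((r / \<bar>c\<bar>) powr p)"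
      using int by (intro mult_left_mono) auto
    also have "\<dots> = ennreal (r powr p)"
      using False r by (simp add: powr_divide flip: ennreal_mult)
    finally show "Lp_norm M p (\<lambda>\<omega>. c *\<^sub>R Y \<omega>) \<le> ennreal r"
      using p r by (simp add: Lp_norm_le_iff)
  qed
qed

text \<open>
  If \<open>r\<close> and \<open>s\<close> bound the norms of \<open>Y\<close> and \<open>Z\<close>, then \<open>(Y + Z) / (r + s)\<close> is the convex combination
  of \<open>Y / r\<close> and \<open>Z / s\<close> with weights \<open>r / (r + s)\<close> and \<open>s / (r + s)\<close>, so the convexity of the \<open>p\<close>-th
  power of the norm bounds its \<open>p\<close>-th moment by \<open>1\<close>. Taking \<open>r\<close> and \<open>s\<close> strictly positive avoids
  division by a vanishing norm.
\<close>

lemma Lp_norm_Minkowski: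
  fixes Y Z :: "'a \<Rightarrow> 'e::real_normed_vector"
  assumes p: "p \<ge> 1" and Y: "Y \<in> borel_measurable M" and Z: "Z \<in> borel_measurable M"
  shows "Lp_norm M p (\<lambda>\<omega>. Y \<omega> + Z \<omega>) \<le> Lp_norm M p Y + Lp_norm M p Z"
proof (cases "Lp_norm M p Y = \<infinity> \<or> Lp_norm M p Z = \<infinity>")
  case True
  then show ?thesis by auto
next
  case False
  have meas: "(\<lambda>\<omega>. norm (Y \<omega>)) \<in> borel_measurable M" "(\<lambda>\<omega>. norm (Z \<omega>)) \<in> borel_measurable M"
    using Y Z by simp_all
  have key: "Lp_norm M p (\<lambda>\<omega>. Y \<omega> + Z \<omega>) \<le> ennreal (r + s)"
    if r: "0 < r" "Lp_norm M p Y \<le> ennreal r" and s: "0 < s" "Lp_norm M p Z \<le> ennreal s" for r s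
  proof -
    define c where "c = s / (r + s)"
    have c: "0 \<le> c" "c \<le> 1" "1 - c = r / (r + s)"
      using r s by (auto simp: c_def field_simps)
    define C where "C = (r + s) powr p"
    have C: "0 \<le> C" by (simp add: C_def)
    have pt: "norm (Y \<omega> + Z \<omega>) powr p
        \<le> C * (1 - c) / r powr p * norm (Y \<omega>) powr p + C * c / s powr p * norm (Z \<omega>) powr p" for \<omega>
    proof -
      have e: "Y \<omega> + Z \<omega> = (r + s) *\<^sub>R ((1 - c) *\<^sub>R ((1 / r) *\<^sub>R Y \<omega>) + c *\<^sub>R ((1 / s) *\<^sub>R Z \<omega>))"
        using r s unfolding c(3) by (simp add: c_def scaleR_add_right)
      have "norm (Y \<omega> + Z \<omega>) powr p
          = C * norm ((1 - c) *\<^sub>R ((1 / r) *\<^sub>R Y \<omega>) + c *\<^sub>R ((1 / s) *\<^sub>R Z \<omega>)) powr p"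
        unfolding e norm_scaleR C_def using r s by (simp add: powr_mult)
      also have "\<dots> \<le> C * ((1 - c) * norm ((1 / r) *\<^sub>R Y \<omega>) powr p + c * norm ((1 / s) *\<^sub>R Z \<omega>) powr p)"
        by (intro mult_left_mono norm_powr_convex p c C)
      also have "\<dots> = C * (1 - c) / r powr p * norm (Y \<omega>) powr p + C * c / s powr p * norm (Z \<omega>) powr p"
        using r s by (simp add: powr_divide distrib_left)
      finally show ?thesis .
    qed
    have "(\<integral>\<^sup>+ \<omega>. ennreal (norm (Y \<omega> + Z \<omega>) powr p) \<partial>M)
        \<le> (\<integral>\<^sup>+ \<omega>. ennreal (C * (1 - c) / r powr p) * ennreal (norm (Y \<omega>) powr p)
              + ennreal (C * c / s powr p) * ennreal (norm (Z \<omega>) powr p) \<partial>M)"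
      using pt C c(1,2) by (intro nn_integral_mono) (simp flip: ennreal_mult ennreal_plus)
    also have "\<dots> = ennreal (C * (1 - c) / r powr p) * (\<integral>\<^sup>+ \<omega>. ennreal (norm (Y \<omega>) powr p) \<partial>M)
              + ennreal (C * c / s powr p) * (\<integral>\<^sup>+ \<omega>. ennreal (norm (Z \<omega>) powr p) \<partial>M)"
      using meas by (simp add: nn_integral_add nn_integral_cmult)
    also have "\<dots> \<le> ennreal (C * (1 - c) / r powr p) * ennreal (r powr p)
              + ennreal (C * c / s powr p) * ennreal (s powr p)"
      using r s p by (intro add_mono mult_left_mono) (auto simp: Lp_norm_le_iff)
    also have "\<dots> = ennreal (C * (1 - c) + C * c)"
      using C c(1,2) r s by (simp flip: ennreal_mult ennreal_plus)
    also have "C * (1 - c) + C * c = (r + s) powr p"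
      by (simp add: C_def algebra_simps)
    finally show ?thesis
      using r s p by (subst Lp_norm_le_iff) auto
  qed
  obtain A B where A: "0 \<le> A" "Lp_norm M p Y = ennreal A" and B: "0 \<le> B" "Lp_norm M p Z = ennreal B"
    using False by (metis ennreal_cases infinity_ennreal_def)
  show ?thesis
  proof (rule ennreal_le_epsilon)
    fix e :: real assume e: "0 < e"
    have "Lp_norm M p (\<lambda>\<omega>. Y \<omega> + Z \<omega>) \<le> ennreal ((A + e / 2) + (B + e / 2))"
      using A B e by (intro key) (auto intro!: ennreal_leI)
    also have "\<dots> = Lp_norm M p Y + Lp_norm M p Z + ennreal e"
      using A B e by (simp flip: ennreal_plus)
    finally show "Lp_norm M p (\<lambda>\<omega>. Y \<omega> + Z \<omega>) \<le> Lp_norm M p Y + Lp_norm M p Z + ennreal e" .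
  qed
qed

text \<open>
  Measurability is required of the partial sums because sums of Borel functions into a
  nonseparable space need not be Borel.
\<close>

lemma Lp_norm_sum_le:
  fixes Y :: "'i \<Rightarrow> 'a \<Rightarrow> 'e::real_normed_vector"
  assumes p: "p \<ge> 1" and "finite J"
    and Y: "\<And>K. K \<subseteq> J \<Longrightarrow> (\<lambda>\<omega>. \<Sum>j\<in>K. Y j \<omega>) \<in> borel_measurable M"
  shows "Lp_norm M p (\<lambda>\<omega>. \<Sum>j\<in>J. Y j \<omega>) \<le> (\<Sum>j\<in>J. Lp_norm M p (Y j))"
  using \<open>finite J\<close> Y
proof (induction J)
  case empty
  then show ?case by (simp add: Lp_norm_def)
next
  case (insert j J)
  have "Lp_norm M p (\<lambda>\<omega>. Y j \<omega> + (\<Sum>j\<in>J. Y j \<omega>)) \<le> Lp_norm M p (Y j) + Lp_norm M p (\<lambda>\<omega>. \<Sum>j\<in>J. Y j \<omega>)"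
    using insert.prems[of "{j}"] insert.prems[of J] by (intro Lp_norm_Minkowski p) auto
  also have "\<dots> \<le> Lp_norm M p (Y j) + (\<Sum>j\<in>J. Lp_norm M p (Y j))"
    using insert.prems by (intro add_left_mono insert.IH) auto
  finally show ?case using insert.hyps by simp
qed

section \<open>Extraction of the components from a dyadic contraction\<close>

text \<open>
  The recursion is the bookkeeping of the induction in \<open>Lp_norm_components_le\<close>: the components of
  degree at most \<open>m\<close> cost \<open>c = chaos_const m * (2 ^ Suc m + 1)\<close>, and the top one costs \<open>1 + c\<close>.
\<close>

fun chaos_const :: "nat \<Rightarrow> real" where
  "chaos_const 0 = 1"
| "chaos_const (Suc m) = 1 + 2 * chaos_const m * (2 ^ Suc m + 1)"

lemma chaos_const_ge_1: "chaos_const m \<ge> 1"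
  by (induction m) (auto simp: add_nonneg_nonneg)

text \<open>
  Let \<open>S\<close> be the sum of the components \<open>b j *\<^sub>R q j\<close> for \<open>j \<le> m + 1\<close>, and \<open>H\<close> the sum of their
  multiples by \<open>(1 / 2) ^ j\<close>, whose norm is at most that of \<open>S\<close>. In \<open>R = 2 ^ (m + 1) *\<^sub>R H - S\<close> the top
  component cancels, while the others are multiplied by \<open>2 ^ (m + 1 - j) - 1 \<ge> 1\<close>. Hence the
  induction hypothesis for \<open>R\<close> controls the components of degree at most \<open>m\<close>, and the top component
  is what remains of \<open>S\<close>. The contraction is assumed for all coefficients \<open>b\<close> since \<open>R\<close> has
  coefficients different from those of \<open>S\<close>; coefficients that vanish above \<open>m\<close> give the lower degrees.
\<close>

lemma Lp_norm_components_le: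
  fixes q :: "nat \<Rightarrow> 'a \<Rightarrow> 'e::real_normed_vector"
  assumes p: "p \<ge> 1"
    and meas: "\<And>b. (\<lambda>\<omega>. \<Sum>j\<le>d. b j *\<^sub>R q j \<omega>) \<in> borel_measurable M"
    and half: "\<And>b. Lp_norm M p (\<lambda>\<omega>. \<Sum>j\<le>d. ((1 / 2) ^ j * b j) *\<^sub>R q j \<omega>)
                  \<le> Lp_norm M p (\<lambda>\<omega>. \<Sum>j\<le>d. b j *\<^sub>R q j \<omega>)"
    and "m \<le> d"
  shows "(\<Sum>j\<le>m. Lp_norm M p (\<lambda>\<omega>. b j *\<^sub>R q j \<omega>))
           \<le> ennreal (chaos_const m) * Lp_norm M p (\<lambda>\<omega>. \<Sum>j\<le>m. b j *\<^sub>R q j \<omega>)"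
proof -
  define N :: "('a \<Rightarrow> 'e) \<Rightarrow> ennreal" where "N = Lp_norm M p"
  have restrict: "(\<Sum>j\<in>K. b j *\<^sub>R q j \<omega>) = (\<Sum>j\<le>d. (if j \<in> K then b j else 0) *\<^sub>R q j \<omega>)"
    if "K \<subseteq> {..d}" for K b \<omega>
    using that by (intro sum.mono_neutral_cong_left) auto
  have meas': "(\<lambda>\<omega>. \<Sum>j\<in>K. b j *\<^sub>R q j \<omega>) \<in> borel_measurable M" if "K \<subseteq> {..d}" for K b
    unfolding restrict[OF that] by (rule meas)
  have half': "N (\<lambda>\<omega>. \<Sum>j\<le>m. ((1 / 2) ^ j * b j) *\<^sub>R q j \<omega>) \<le> N (\<lambda>\<omega>. \<Sum>j\<le>m. b j *\<^sub>R q j \<omega>)"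
    if "m \<le> d" for m b
  proof -
    have K: "{..m} \<subseteq> {..d}" using that by auto
    have "(\<Sum>j\<le>m. ((1 / 2) ^ j * b j) *\<^sub>R q j \<omega>)
        = (\<Sum>j\<le>d. ((1 / 2) ^ j * (if j \<in> {..m} then b j else 0)) *\<^sub>R q j \<omega>)" for \<omega>
      unfolding restrict[OF K] by (intro sum.cong) auto
    then show ?thesis
      unfolding restrict[OF K, of b] using half by (simp add: N_def)
  qed
  show ?thesis
    unfolding N_def[symmetric] using \<open>m \<le> d\<close>
  proof (induction m arbitrary: b)
    case 0
    then show ?case by simp
  next
    case (Suc m)
    let ?S = "\<lambda>\<omega>. \<Sum>j\<le>Suc m. b j *\<^sub>R q j \<omega>"
    let ?H = "\<lambda>\<omega>. \<Sum>j\<le>Suc m. ((1 / 2) ^ j * b j) *\<^sub>R q j \<omega>"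
    define b' where "b' j = (2 ^ Suc m * (1 / 2) ^ j - 1) * b j" for j :: nat
    let ?R = "\<lambda>\<omega>. \<Sum>j\<le>m. b' j *\<^sub>R q j \<omega>"
    let ?T = "\<lambda>\<omega>. \<Sum>j\<le>m. b j *\<^sub>R q j \<omega>"
    have R: "?R = (\<lambda>\<omega>. 2 ^ Suc m *\<^sub>R ?H \<omega> + (- 1) *\<^sub>R ?S \<omega>)"
    proof
      fix \<omega>
      have top: "b' (Suc m) = 0"
        by (simp add: b'_def power_one_over)
      have "?R \<omega> = (\<Sum>j\<le>Suc m. b' j *\<^sub>R q j \<omega>)"
        by (simp add: top)
      also have "\<dots> = 2 ^ Suc m *\<^sub>R ?H \<omega> + (- 1) *\<^sub>R ?S \<omega>"
        unfolding scaleR_sum_right sum.distrib[symmetric] scaleR_scaleR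
        by (intro sum.cong refl) (simp add: b'_def algebra_simps)
      finally show "?R \<omega> = 2 ^ Suc m *\<^sub>R ?H \<omega> + (- 1) *\<^sub>R ?S \<omega>" .
    qed
    have K: "{..Suc m} \<subseteq> {..d}" "{..m} \<subseteq> {..d}" using Suc.prems by auto
    have scale: "N (\<lambda>\<omega>. c *\<^sub>R (\<Sum>j\<in>K. f j *\<^sub>R q j \<omega>)) \<le> ennreal \<bar>c\<bar> * N (\<lambda>\<omega>. \<Sum>j\<in>K. f j *\<^sub>R q j \<omega>)"
      if "K \<subseteq> {..d}" for c f K
      unfolding N_def using p meas'[OF that] by (intro Lp_norm_scaleR_le) auto
    have scm: "(\<lambda>\<omega>. c *\<^sub>R (\<Sum>j\<in>K. f j *\<^sub>R q j \<omega>)) \<in> borel_measurable M"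
      if "K \<subseteq> {..d}" for c f K
      unfolding scaleR_sum_right scaleR_scaleR by (rule meas'[OF that])
    have "N ?R \<le> N (\<lambda>\<omega>. 2 ^ Suc m *\<^sub>R ?H \<omega>) + N (\<lambda>\<omega>. (- 1) *\<^sub>R ?S \<omega>)"
      unfolding R unfolding N_def by (intro Lp_norm_Minkowski p scm K)
    also have "\<dots> \<le> ennreal \<bar>2 ^ Suc m\<bar> * N ?H + ennreal \<bar>- 1\<bar> * N ?S"
      by (intro add_mono scale K)
    also have "\<dots> \<le> ennreal \<bar>2 ^ Suc m\<bar> * N ?S + ennreal \<bar>- 1\<bar> * N ?S"
      by (intro add_mono mult_left_mono half' Suc.prems) auto
    also have "\<dots> = ennreal (2 ^ Suc m + 1) * N ?S"
      by (simp add: distrib_right)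
    finally have NR: "N ?R \<le> ennreal (2 ^ Suc m + 1) * N ?S" .
    have "(\<Sum>j\<le>m. N (\<lambda>\<omega>. b j *\<^sub>R q j \<omega>)) \<le> (\<Sum>j\<le>m. N (\<lambda>\<omega>. b' j *\<^sub>R q j \<omega>))"
    proof (rule sum_mono)
      fix j assume "j \<in> {..m}"
      then have "(2::real) ^ Suc m * (1 / 2) ^ j = 2 ^ (Suc m - j)"
        by (simp add: power_one_over power_diff field_simps)
      moreover have "(2::real) ^ 1 \<le> 2 ^ (Suc m - j)"
        using \<open>j \<in> {..m}\<close> by (intro power_increasing) auto
      ultimately have "1 \<le> \<bar>2 ^ Suc m * (1 / 2) ^ j - (1::real)\<bar>"
        by simp
      then have "\<bar>b j\<bar> \<le> \<bar>b' j\<bar>"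
        using mult_right_mono[of 1 "\<bar>2 ^ Suc m * (1 / 2) ^ j - (1::real)\<bar>" "\<bar>b j\<bar>"]
        by (simp add: b'_def abs_mult)
      then show "N (\<lambda>\<omega>. b j *\<^sub>R q j \<omega>) \<le> N (\<lambda>\<omega>. b' j *\<^sub>R q j \<omega>)"
        unfolding N_def using p by (intro Lp_norm_mono_pointwise) (auto intro: mult_right_mono)
    qed
    also have "\<dots> \<le> ennreal (chaos_const m) * N ?R"
      using Suc.prems by (intro Suc.IH) auto
    also have "\<dots> \<le> ennreal (chaos_const m) * (ennreal (2 ^ Suc m + 1) * N ?S)"
      by (intro mult_left_mono NR) auto
    also have "\<dots> = ennreal (chaos_const m * (2 ^ Suc m + 1)) * N ?S"
      using chaos_const_ge_1[of m] by (subst ennreal_mult) (auto simp: mult.assoc)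
    finally have low: "(\<Sum>j\<le>m. N (\<lambda>\<omega>. b j *\<^sub>R q j \<omega>)) \<le> ennreal (chaos_const m * (2 ^ Suc m + 1)) * N ?S" .
    have "N (\<lambda>\<omega>. b (Suc m) *\<^sub>R q (Suc m) \<omega>) = N (\<lambda>\<omega>. ?S \<omega> + (- 1) *\<^sub>R ?T \<omega>)"
      by simp
    also have "\<dots> \<le> N ?S + N (\<lambda>\<omega>. (- 1) *\<^sub>R ?T \<omega>)"
      unfolding N_def by (intro Lp_norm_Minkowski p scm K meas')
    also have "\<dots> \<le> N ?S + ennreal \<bar>- 1\<bar> * N ?T"
      by (intro add_left_mono scale K)
    also have "\<dots> \<le> N ?S + (\<Sum>j\<le>m. N (\<lambda>\<omega>. b j *\<^sub>R q j \<omega>))"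
      using K Lp_norm_sum_le[OF p, of "{..m}" "\<lambda>j \<omega>. b j *\<^sub>R q j \<omega>" M] meas'
      by (simp add: N_def subset_trans add_left_mono)
    also have "\<dots> \<le> N ?S + ennreal (chaos_const m * (2 ^ Suc m + 1)) * N ?S"
      by (intro add_left_mono low)
    finally have high: "N (\<lambda>\<omega>. b (Suc m) *\<^sub>R q (Suc m) \<omega>)
        \<le> N ?S + ennreal (chaos_const m * (2 ^ Suc m + 1)) * N ?S" .
    define c where "c = chaos_const m * (2 ^ Suc m + 1)"
    have c: "0 \<le> c" using chaos_const_ge_1[of m] by (simp add: c_def)
    have "(\<Sum>j\<le>Suc m. N (\<lambda>\<omega>. b j *\<^sub>R q j \<omega>)) \<le> ennreal c * N ?S + (N ?S + ennreal c * N ?S)"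
      using low high unfolding c_def[symmetric] by (simp add: add_mono)
    also have "\<dots> = ennreal (1 + 2 * c) * N ?S"
    proof -
      have "1 + 2 * c = c + (1 + c)" by simp
      then have "ennreal (1 + 2 * c) = ennreal c + (1 + ennreal c)"
        using c by (simp only: ennreal_plus ennreal_1 add_nonneg_nonneg zero_le_one)
      then show ?thesis by (simp only: distrib_right mult_1)
    qed
    also have "1 + 2 * c = chaos_const (Suc m)"
      by (simp add: c_def)
    finally show ?case .
  qed
qed

section \<open>Dilating centred coordinates\<close>

text \<open>
  The function \<open>g t = norm (u + t *\<^sub>R v) powr p\<close> is convex on the real line, hence
  \<open>g (c * t) \<le> (1 - c) * g 0 + c * g t\<close>, and Jensen's inequality gives \<open>g 0 \<le> \<E> g\<close> because the mean is
  \<open>0\<close>. Only the real Jensen inequality enters, although \<open>u\<close> and \<open>v\<close> are vectors.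
\<close>

lemma nn_integral_norm_powr_dilate_le:
  fixes u v :: "'e::real_normed_vector" and N :: "real measure"
  assumes "prob_space N" and sets: "sets N = sets borel"
    and int: "integrable N (\<lambda>t. t)" and mean: "(\<integral>t. t \<partial>N) = 0"
    and p: "p \<ge> 1" and c: "0 \<le> c" "c \<le> 1"
  shows "(\<integral>\<^sup>+t. ennreal (norm (u + (c * t) *\<^sub>R v) powr p) \<partial>N)
           \<le> (\<integral>\<^sup>+t. ennreal (norm (u + t *\<^sub>R v) powr p) \<partial>N)"
proof -
  interpret prob_space N by fact
  define g where "g t = norm (u + t *\<^sub>R v) powr p" for t
  have "(\<lambda>t. norm (u + t *\<^sub>R v)) \<in> borel_measurable borel"
    by (intro borel_measurable_continuous_onI continuous_intros)
  then have meas: "g \<in> borel_measurable N"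
    unfolding g_def measurable_cong_sets[OF sets refl] by measurable
  have convex: "g ((1 - s) *\<^sub>R x + s *\<^sub>R y) \<le> (1 - s) * g x + s * g y"
    if "0 \<le> s" "s \<le> 1" for s x y :: real
  proof -
    have "u + ((1 - s) *\<^sub>R x + s *\<^sub>R y) *\<^sub>R v = (1 - s) *\<^sub>R (u + x *\<^sub>R v) + s *\<^sub>R (u + y *\<^sub>R v)"
      by (simp add: algebra_simps)
    then show ?thesis
      using norm_powr_convex[OF p that, of "u + x *\<^sub>R v" "u + y *\<^sub>R v"] by (simp add: g_def)
  qed
  have g_nonneg: "0 \<le> g t" for t by (simp add: g_def)
  have "(\<integral>\<^sup>+t. ennreal (g (c * t)) \<partial>N) \<le> (\<integral>\<^sup>+t. ennreal (g t) \<partial>N)"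
  proof (cases "(\<integral>\<^sup>+t. ennreal (g t) \<partial>N) = \<infinity>")
    case True
    then show ?thesis by simp
  next
    case False
    then have g_int: "integrable N g"
      using meas by (intro integrableI_nonneg) (auto simp: g_nonneg top.not_eq_extremum)
    have "g (expectation (\<lambda>t. t)) \<le> expectation (\<lambda>t. g t)"
      using g_int convex
      by (intro jensens_inequality[where I = UNIV] int) (auto intro!: convex_onI)
    then have "ennreal (g 0) \<le> (\<integral>\<^sup>+t. ennreal (g t) \<partial>N)"
      using g_int by (subst nn_integral_eq_integral) (auto simp: mean g_nonneg intro: ennreal_leI)
    note at_0 = this
    have "(\<integral>\<^sup>+t. ennreal (g (c * t)) \<partial>N)
        \<le> (\<integral>\<^sup>+t. ennreal ((1 - c) * g 0) + ennreal c * ennreal (g t) \<partial>N)"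
      using convex[OF c, of 0] c g_nonneg
      by (intro nn_integral_mono) (simp flip: ennreal_mult ennreal_plus)
    also have "\<dots> = ennreal (1 - c) * ennreal (g 0) + ennreal c * (\<integral>\<^sup>+t. ennreal (g t) \<partial>N)"
      using meas c g_nonneg
      by (simp add: nn_integral_add nn_integral_cmult emeasure_space_1 ennreal_mult)
    also have "\<dots> \<le> ennreal (1 - c) * (\<integral>\<^sup>+t. ennreal (g t) \<partial>N) + ennreal c * (\<integral>\<^sup>+t. ennreal (g t) \<partial>N)"
      by (intro add_right_mono mult_left_mono at_0) auto
    also have "\<dots> = ennreal (1 - c + c) * (\<integral>\<^sup>+t. ennreal (g t) \<partial>N)"
      using c by (subst ennreal_plus) (auto simp: distrib_right)
    finally show ?thesis by simp
  qed
  then show ?thesis by (simp add: g_def)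
qed

text \<open>
  This makes continuous functions of a whole sequence measurable on a product over an index set
  \<open>I\<close>: the points of that product take one fixed value outside \<open>I\<close>. Since the index type is countable,
  the Borel sets of the product topology are those of the product \<open>\<sigma>\<close>-algebra. In this way functions
  into a nonseparable normed space are treated, for which measurability of sums is not automatic.
\<close>

lemma measurable_identity_PiM_borel:
  fixes I :: "'i::countable set"
  shows "(\<lambda>x. x) \<in> measurable (\<Pi>\<^sub>M i\<in>I. borel) (borel :: ('i \<Rightarrow> real) measure)"
proof -
  have "(\<lambda>x. x i) \<in> measurable (\<Pi>\<^sub>M i\<in>I. borel) (borel :: real measure)" for i
  proof (cases "i \<in> I")
    case False
    then have "x i = undefined" if "x \<in> space (\<Pi>\<^sub>M i\<in>I. (borel :: real measure))" for x
      using that by (auto simp: space_PiM PiE_def extensional_def)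
    then show ?thesis
      by (subst measurable_cong[where g = "\<lambda>_. undefined"]) auto
  qed simp
  then have "(\<lambda>x. x) \<in> measurable (\<Pi>\<^sub>M i\<in>I. borel) (\<Pi>\<^sub>M i\<in>(UNIV :: 'i set). (borel :: real measure))"
    by (intro measurable_PiM_single') auto
  then show ?thesis
    by (simp add: sets_PiM_equal_borel cong: measurable_cong_sets)
qed

text \<open>
  Dilating one coordinate after the other, Fubini's theorem reduces each step to
  \<open>nn_integral_norm_powr_dilate_le\<close>, since \<open>F\<close> is affine in each variable.
\<close>

lemma nn_integral_PiM_dilate_le:
  fixes F :: "('i::countable \<Rightarrow> real) \<Rightarrow> 'e::real_normed_vector" and N :: "'i \<Rightarrow> real measure"
  assumes prob: "\<And>i. prob_space (N i)" and sets: "\<And>i. sets (N i) = sets borel"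
    and int: "\<And>i. integrable (N i) (\<lambda>t. t)" and mean: "\<And>i. (\<integral>t. t \<partial>N i) = 0"
    and I: "finite I" and J: "J \<subseteq> I"
    and cont: "continuous_on UNIV F"
    and affine: "\<And>i x. \<exists>u v. \<forall>t. F (x(i := t)) = u + t *\<^sub>R v"
    and p: "p \<ge> 1" and c: "0 \<le> c" "c \<le> 1"
  shows "(\<integral>\<^sup>+x. ennreal (norm (F (\<lambda>i. if i \<in> J then c * x i else x i)) powr p) \<partial>(\<Pi>\<^sub>M i\<in>I. N i))
           \<le> (\<integral>\<^sup>+x. ennreal (norm (F x) powr p) \<partial>(\<Pi>\<^sub>M i\<in>I. N i))"
proof -
  interpret product_sigma_finite N
    using prob by (intro product_sigma_finite.intro prob_space_imp_sigma_finite)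
  have meas: "(\<lambda>x. ennreal (norm (G x) powr p)) \<in> borel_measurable (\<Pi>\<^sub>M i\<in>I. N i)"
    if "continuous_on UNIV G" for G :: "('i \<Rightarrow> real) \<Rightarrow> 'e"
  proof -
    have "(\<lambda>x. norm (G x)) \<in> borel_measurable borel"
      using that by (intro borel_measurable_continuous_onI continuous_intros)
    then have "(\<lambda>x. ennreal (norm (G x) powr p)) \<in> borel_measurable borel"
      by measurable
    from measurable_compose[OF measurable_identity_PiM_borel[of I] this] show ?thesis
      by (simp cong: measurable_cong_sets sets_PiM_cong add: sets)
  qed
  define F' where "F' K x = F (\<lambda>i. if i \<in> K then c * x i else x i)" for K x
  have cont': "continuous_on UNIV (F' K)" for K
    unfolding F'_def
  proof (intro continuous_on_compose2[OF cont] continuous_on_coordinatewise_then_product)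
    fix i
    show "continuous_on UNIV (\<lambda>x. if i \<in> K then c * x i else x i)"
      by (cases "i \<in> K") (auto intro!: continuous_intros)
  qed simp
  have affine': "\<exists>u v. \<forall>t. F' K (x(i := t)) = u + t *\<^sub>R v" for K i x
  proof -
    obtain u v where uv: "\<And>t. F ((\<lambda>i. if i \<in> K then c * x i else x i)(i := t)) = u + t *\<^sub>R v"
      using affine by blast
    have "(\<lambda>k. if k \<in> K then c * (x(i := t)) k else (x(i := t)) k)
        = (\<lambda>i. if i \<in> K then c * x i else x i)(i := if i \<in> K then c * t else t)" for t
      by auto
    then have "F' K (x(i := t)) = u + t *\<^sub>R ((if i \<in> K then c else 1) *\<^sub>R v)" for t
      by (simp add: F'_def uv mult.commute)
    then show ?thesis by blast
  qed
  have "finite J" using I J finite_subset by auto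
  then have "(\<integral>\<^sup>+x. ennreal (norm (F' J x) powr p) \<partial>(\<Pi>\<^sub>M i\<in>I. N i))
           \<le> (\<integral>\<^sup>+x. ennreal (norm (F x) powr p) \<partial>(\<Pi>\<^sub>M i\<in>I. N i))"
    using J
  proof (induction J)
    case empty
    then show ?case by (simp add: F'_def)
  next
    case (insert i K)
    define I' where "I' = I - {i}"
    have I': "finite I'" "i \<notin> I'" "I = insert i I'"
      using I insert.prems by (auto simp: I'_def)
    have step: "F' (insert i K) (x(i := t)) = F' K (x(i := c * t))" for x t
      unfolding F'_def using insert.hyps by (intro arg_cong[where f = F]) auto
    note fubini = product_nn_integral_insert[OF I'(1,2), folded I'(3), OF meas[OF cont']]
    have "(\<integral>\<^sup>+x. ennreal (norm (F' (insert i K) x) powr p) \<partial>(\<Pi>\<^sub>M i\<in>I. N i))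
        = (\<integral>\<^sup>+x. (\<integral>\<^sup>+t. ennreal (norm (F' K (x(i := c * t))) powr p) \<partial>N i) \<partial>(\<Pi>\<^sub>M i\<in>I'. N i))"
      by (simp add: fubini step)
    also have "\<dots> \<le> (\<integral>\<^sup>+x. (\<integral>\<^sup>+t. ennreal (norm (F' K (x(i := t))) powr p) \<partial>N i) \<partial>(\<Pi>\<^sub>M i\<in>I'. N i))"
    proof (rule nn_integral_mono)
      fix x
      obtain u v where "\<And>t. F' K (x(i := t)) = u + t *\<^sub>R v"
        using affine' by blast
      then show "(\<integral>\<^sup>+t. ennreal (norm (F' K (x(i := c * t))) powr p) \<partial>N i)
          \<le> (\<integral>\<^sup>+t. ennreal (norm (F' K (x(i := t))) powr p) \<partial>N i)"
        using nn_integral_norm_powr_dilate_le[OF prob sets int mean p c] by simp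
    qed
    also have "\<dots> = (\<integral>\<^sup>+x. ennreal (norm (F' K x) powr p) \<partial>(\<Pi>\<^sub>M i\<in>I. N i))"
      by (simp add: fubini)
    also have "\<dots> \<le> (\<integral>\<^sup>+x. ennreal (norm (F x) powr p) \<partial>(\<Pi>\<^sub>M i\<in>I. N i))"
      using insert by auto
    finally show ?case .
  qed
  then show ?thesis by (simp add: F'_def)
qed

section \<open>Chaoses as polynomials in the coordinates\<close>

text \<open>
  Putting deterministic variables in place of the random ones separates the algebra of chaoses and
  their continuity from the joint law of the variables.
\<close>

definition chaos_poly :: "nat \<Rightarrow> nat \<Rightarrow> (nat \<Rightarrow> nat list \<Rightarrow> 'e::real_normed_vector) \<Rightarrow> (nat \<Rightarrow> real) \<Rightarrow> 'e"
  where "chaos_poly n d a x = (\<Sum>j\<le>d. homogeneous_chaos n j (a j) (\<lambda>i y. y i) x)"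

lemma homogeneous_chaos_linear_image:
  assumes "linear T"
  shows "homogeneous_chaos n j (\<lambda>is. T (a is)) X \<omega> = T (homogeneous_chaos n j a X \<omega>)"
  using assms by (simp add: homogeneous_chaos_def linear_sum linear_scale)

lemma homogeneous_chaos_scaleR_array:
  "homogeneous_chaos n j (\<lambda>is. r *\<^sub>R a is) X \<omega> = r *\<^sub>R homogeneous_chaos n j a X \<omega>"
  by (rule homogeneous_chaos_linear_image) (rule linear_scaleR)

lemma finite_multi_indices: "finite (multi_indices n j)"
  using finite_lists_length_eq[of "{1..n}" j] by (simp add: multi_indices_def conj_commute)

lemma chaos_poly_eq:
  assumes "\<And>i. i \<in> {1..n} \<Longrightarrow> x i = X i \<omega>"
  shows "chaos_poly n d a x = (\<Sum>j\<le>d. homogeneous_chaos n j (a j) X \<omega>)"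
  unfolding chaos_poly_def homogeneous_chaos_def
proof (intro sum.cong refl arg_cong2[where f = scaleR] arg_cong[where f = prod_list] map_cong)
  fix j "is" i assume "is \<in> multi_indices n j" "i \<in> set is"
  then have "i \<in> {1..n}" unfolding multi_indices_def by blast
  then show "x i = X i \<omega>" by (rule assms)
qed

lemma chaos_poly_dilate:
  "chaos_poly n d a (\<lambda>i. c * x i) = (\<Sum>j\<le>d. c ^ j *\<^sub>R homogeneous_chaos n j (a j) (\<lambda>i y. y i) x)"
proof -
  have "prod_list (map (\<lambda>i. c * x i) is) = c ^ length is * prod_list (map x is)" for "is"
    by (induction "is") auto
  then show ?thesis
    by (auto simp: chaos_poly_def homogeneous_chaos_def scaleR_sum_right multi_indices_def
        intro!: sum.cong)
qed

lemma continuous_chaos_poly: "continuous_on UNIV (chaos_poly n d a)"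
proof -
  have "continuous_on UNIV (\<lambda>x::nat \<Rightarrow> real. prod_list (map (\<lambda>i. x i) is))" for "is"
    by (induction "is") (auto intro!: continuous_intros)
  then show ?thesis
    unfolding chaos_poly_def homogeneous_chaos_def by (intro continuous_intros)
qed

lemma prod_list_distinct_affine:
  fixes x :: "'i \<Rightarrow> real"
  assumes "distinct is"
  shows "\<exists>u v. \<forall>t. prod_list (map (x(i := t)) is) = u + t * v"
  using assms
proof (induction "is")
  case Nil
  have "\<forall>t. prod_list (map (x(i := t)) []) = 1 + t * 0" by simp
  then show ?case by blast
next
  case (Cons k "is")
  show ?case
  proof (cases "k = i")
    case True
    have "prod_list (map (x(i := t)) is) = prod_list (map x is)" for t
      using Cons.prems True by (intro arg_cong[where f = prod_list] map_cong) auto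
    then have "\<forall>t. prod_list (map (x(i := t)) (k # is)) = 0 + t * prod_list (map x is)"
      using True by simp
    then show ?thesis by blast
  next
    case False
    obtain u v where "\<forall>t. prod_list (map (x(i := t)) is) = u + t * v"
      using Cons.IH Cons.prems by fastforce
    then have "\<forall>t. prod_list (map (x(i := t)) (k # is)) = x k * u + t * (x k * v)"
      using False by (simp add: algebra_simps)
    then show ?thesis by blast
  qed
qed

text \<open>
  Each variable occurs at most to the first power because the coefficients vanish on diagonals.
\<close>

lemma chaos_poly_affine:
  assumes vanish: "\<And>j. j \<le> d \<Longrightarrow> vanishes_on_diagonals n j (a j)"
  shows "\<exists>u v. \<forall>t. chaos_poly n d a (x(i := t)) = u + t *\<^sub>R v"
proof -
  have "\<exists>u v. \<forall>t. prod_list (map (x(i := t)) is) *\<^sub>R a j is = u + t *\<^sub>R v"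
    if "j \<le> d" "is \<in> multi_indices n j" for j "is"
  proof (cases "distinct is")
    case True
    then obtain u v where "\<And>t. prod_list (map (x(i := t)) is) = u + t * v"
      using prod_list_distinct_affine[of "is" x i] by auto
    then have "\<forall>t. prod_list (map (x(i := t)) is) *\<^sub>R a j is = u *\<^sub>R a j is + t *\<^sub>R (v *\<^sub>R a j is)"
      by (simp add: algebra_simps)
    then show ?thesis by blast
  next
    case False
    have "length is = j" using that by (simp add: multi_indices_def)
    with False have "\<exists>k l. k < l \<and> l < j \<and> is ! k = is ! l"
      unfolding distinct_conv_nth by (metis nat_neq_iff)
    then have "a j is = 0"
      using vanish[OF that(1)] that(2) by (auto simp: vanishes_on_diagonals_def)
    then have "\<forall>t. prod_list (map (x(i := t)) is) *\<^sub>R a j is = 0 + t *\<^sub>R 0" by simp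
    then show ?thesis by blast
  qed
  then obtain u v where uv: "\<And>j is t. j \<le> d \<Longrightarrow> is \<in> multi_indices n j \<Longrightarrow>
      prod_list (map (x(i := t)) is) *\<^sub>R a j is = u j is + t *\<^sub>R v j is"
    by metis
  have "chaos_poly n d a (x(i := t)) = (\<Sum>j\<le>d. \<Sum>is\<in>multi_indices n j. u j is)
      + t *\<^sub>R (\<Sum>j\<le>d. \<Sum>is\<in>multi_indices n j. v j is)" for t
    unfolding chaos_poly_def homogeneous_chaos_def scaleR_sum_right sum.distrib[symmetric]
    using uv by (intro sum.cong refl) (auto simp del: fun_upd_apply)
  then show ?thesis by blast
qed

lemma chaos_measurable:
  assumes "\<And>i. i \<in> {1..n} \<Longrightarrow> X i \<in> borel_measurable M"
  shows "(\<lambda>\<omega>. \<Sum>j\<le>d. homogeneous_chaos n j (a j) X \<omega>) \<in> borel_measurable M"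
proof -
  define x where "x \<omega> = (\<lambda>i\<in>{1..n}. X i \<omega>)" for \<omega>
  have "x \<in> measurable M (\<Pi>\<^sub>M i\<in>{1..n}. borel)"
    unfolding x_def using assms by (rule measurable_restrict)
  then have "x \<in> measurable M borel"
    using measurable_compose[OF _ measurable_identity_PiM_borel] by blast
  then have "(\<lambda>\<omega>. chaos_poly n d a (x \<omega>)) \<in> borel_measurable M"
    by (rule measurable_compose) (intro borel_measurable_continuous_onI continuous_chaos_poly)
  also have "(\<lambda>\<omega>. chaos_poly n d a (x \<omega>)) = (\<lambda>\<omega>. \<Sum>j\<le>d. homogeneous_chaos n j (a j) X \<omega>)"
    by (intro ext chaos_poly_eq) (simp add: x_def)
  finally show ?thesis .
qed

section \<open>Comparison of a chaos with its components\<close>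

text \<open>
  Multiplying every \<open>X i\<close> by \<open>c\<close> multiplies the component of degree \<open>j\<close> by \<open>c ^ j\<close>. By independence,
  the \<open>p\<close>-th moments are integrals over a product of centred laws, which dilation does not increase.
\<close>

lemma (in prob_space) Lp_norm_dilated_chaos_le:
  fixes a :: "nat \<Rightarrow> nat list \<Rightarrow> 'e::real_normed_vector"
  assumes n: "n \<ge> 1" and vanish: "\<And>j. j \<le> d \<Longrightarrow> vanishes_on_diagonals n j (a j)"
    and indep: "indep_vars (\<lambda>_. borel) X {1..n}"
    and centred: "\<And>i. i \<in> {1..n} \<Longrightarrow> integrable M (X i) \<and> (\<integral>\<omega>. X i \<omega> \<partial>M) = 0"
    and p: "p \<ge> 1" and c: "0 \<le> c" "c \<le> 1"
  shows "Lp_norm M p (\<lambda>\<omega>. \<Sum>j\<le>d. c ^ j *\<^sub>R homogeneous_chaos n j (a j) X \<omega>)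
           \<le> Lp_norm M p (\<lambda>\<omega>. \<Sum>j\<le>d. homogeneous_chaos n j (a j) X \<omega>)"
proof -
  define I where "I = {1..n}"
  \<comment> \<open>Product measures require a law at every index, also outside \<open>I\<close>.\<close>
  define X' where "X' i = (if i \<in> I then X i else (\<lambda>_. 0))" for i
  define N where "N i = distr M borel (X' i)" for i
  have X'_int: "integrable M (X' i)" and X'_mean: "(\<integral>\<omega>. X' i \<omega> \<partial>M) = 0" for i
    using centred by (auto simp: X'_def I_def)
  then have rv: "X' i \<in> borel_measurable M" for i by simp
  have "indep_vars (\<lambda>_. borel) X' I"
    using indep unfolding I_def[symmetric]
    by (subst indep_vars_cong[where Y = X and J = I and N' = "\<lambda>_. borel"]) (auto simp: X'_def)
  moreover have "I \<noteq> {}" using n by (simp add: I_def)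
  ultimately have joint: "distr M (\<Pi>\<^sub>M i\<in>I. borel) (\<lambda>\<omega>. \<lambda>i\<in>I. X' i \<omega>) = (\<Pi>\<^sub>M i\<in>I. N i)"
    unfolding N_def by (subst (asm) indep_vars_iff_distr_eq_PiM) (auto intro: rv)
  have transfer: "(\<integral>\<^sup>+x. ennreal (norm (G x) powr p) \<partial>(\<Pi>\<^sub>M i\<in>I. N i))
      = (\<integral>\<^sup>+\<omega>. ennreal (norm (G (\<lambda>i\<in>I. X' i \<omega>)) powr p) \<partial>M)"
    if G: "continuous_on UNIV G" for G :: "(nat \<Rightarrow> real) \<Rightarrow> 'e"
  proof -
    have "(\<lambda>x. norm (G x)) \<in> borel_measurable borel"
      using G by (intro borel_measurable_continuous_onI continuous_intros)
    then have "(\<lambda>x. ennreal (norm (G x) powr p)) \<in> borel_measurable borel"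
      by measurable
    then have "(\<lambda>x. ennreal (norm (G x) powr p)) \<in> borel_measurable (\<Pi>\<^sub>M i\<in>I. borel)"
      by (rule measurable_compose[OF measurable_identity_PiM_borel])
    then show ?thesis
      unfolding joint[symmetric] using rv
      by (intro nn_integral_distr) (auto intro: measurable_restrict)
  qed
  have eval: "chaos_poly n d b (\<lambda>i\<in>I. X' i \<omega>) = (\<Sum>j\<le>d. homogeneous_chaos n j (b j) X \<omega>)" for b \<omega>
    by (rule chaos_poly_eq) (simp add: X'_def I_def)
  let ?D = "\<lambda>x i. if i \<in> I then c * x i else x i"
  have dilate: "chaos_poly n d a (?D x) = chaos_poly n d (\<lambda>j is. c ^ j *\<^sub>R a j is) x" for x
  proof -
    have "chaos_poly n d a (?D x) = chaos_poly n d a (\<lambda>i. c * x i)"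
      by (subst chaos_poly_def, rule sym, rule chaos_poly_eq) (auto simp: I_def)
    also have "\<dots> = chaos_poly n d (\<lambda>j is. c ^ j *\<^sub>R a j is) x"
      unfolding chaos_poly_dilate by (simp add: chaos_poly_def homogeneous_chaos_scaleR_array)
    finally show ?thesis .
  qed
  have "(\<integral>\<^sup>+x. ennreal (norm (chaos_poly n d a (?D x)) powr p) \<partial>(\<Pi>\<^sub>M i\<in>I. N i))
      \<le> (\<integral>\<^sup>+x. ennreal (norm (chaos_poly n d a x) powr p) \<partial>(\<Pi>\<^sub>M i\<in>I. N i))"
  proof (rule nn_integral_PiM_dilate_le)
    show "prob_space (N i)" for i unfolding N_def by (rule prob_space_distr[OF rv])
    show "integrable (N i) (\<lambda>t. t)" for i
      unfolding N_def using X'_int rv by (subst integrable_distr_eq) auto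
    show "(\<integral>t. t \<partial>N i) = 0" for i
      unfolding N_def using X'_mean rv by (subst integral_distr) auto
  qed (use p c vanish in \<open>auto simp: N_def I_def intro: continuous_chaos_poly chaos_poly_affine\<close>)
  then have "(\<integral>\<^sup>+\<omega>. ennreal (norm (\<Sum>j\<le>d. c ^ j *\<^sub>R homogeneous_chaos n j (a j) X \<omega>) powr p) \<partial>M)
      \<le> (\<integral>\<^sup>+\<omega>. ennreal (norm (\<Sum>j\<le>d. homogeneous_chaos n j (a j) X \<omega>) powr p) \<partial>M)"
    by (simp add: dilate transfer continuous_chaos_poly eval homogeneous_chaos_scaleR_array)
  then show ?thesis
    using p by (intro Lp_norm_mono) auto
qed

lemma valid_constant_chaos_const:
  "valid_constant TYPE('a) TYPE('e::real_normed_vector) d (chaos_const d)"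
  unfolding valid_constant_def
proof (intro allI impI)
  fix n :: nat and a :: "nat \<Rightarrow> nat list \<Rightarrow> 'e" and M :: "'a measure"
    and X :: "nat \<Rightarrow> 'a \<Rightarrow> real" and p :: real
  assume n: "1 \<le> n" and arrays: "\<forall>j\<le>d. symmetric_array n j (a j) \<and> vanishes_on_diagonals n j (a j)"
    and M: "prob_space M" and indep: "prob_space.indep_vars M (\<lambda>_. borel) X {1..n}"
    and centred: "\<forall>i\<in>{1..n}. integrable M (X i) \<and> (\<integral>\<omega>. X i \<omega> \<partial>M) = 0"
    and p: "1 \<le> p"
  interpret prob_space M by fact
  have rv: "X i \<in> borel_measurable M" if "i \<in> {1..n}" for i
    using centred that by (blast intro: borel_measurable_integrable)
  let ?q = "\<lambda>j. homogeneous_chaos n j (a j) X"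
  have "(\<Sum>j\<le>d. Lp_norm M p (\<lambda>\<omega>. (\<lambda>_. 1) j *\<^sub>R ?q j \<omega>))
      \<le> ennreal (chaos_const d) * Lp_norm M p (\<lambda>\<omega>. \<Sum>j\<le>d. (\<lambda>_. 1) j *\<^sub>R ?q j \<omega>)"
  proof (rule Lp_norm_components_le[OF p _ _ order_refl])
    fix b :: "nat \<Rightarrow> real"
    show "(\<lambda>\<omega>. \<Sum>j\<le>d. b j *\<^sub>R ?q j \<omega>) \<in> borel_measurable M"
      using chaos_measurable[of n X M "\<lambda>j is. b j *\<^sub>R a j is" d] rv by (simp add: homogeneous_chaos_scaleR_array)
    have "vanishes_on_diagonals n j (\<lambda>is. b j *\<^sub>R a j is)" if "j \<le> d" for j
      using arrays that by (auto simp: vanishes_on_diagonals_def)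
    then show "Lp_norm M p (\<lambda>\<omega>. \<Sum>j\<le>d. ((1 / 2) ^ j * b j) *\<^sub>R ?q j \<omega>)
        \<le> Lp_norm M p (\<lambda>\<omega>. \<Sum>j\<le>d. b j *\<^sub>R ?q j \<omega>)"
      using Lp_norm_dilated_chaos_le[of n d "\<lambda>j is. b j *\<^sub>R a j is" X p "1 / 2"] n indep centred p
      by (auto simp: homogeneous_chaos_scaleR_array)
  qed
  then show "(\<Sum>j\<le>d. Lp_norm M p (?q j)) \<le> ennreal (chaos_const d) * Lp_norm M p (\<lambda>\<omega>. \<Sum>j\<le>d. ?q j \<omega>)"
    by simp
qed

section \<open>Isometric embedding of finite-dimensional spans\<close>

text \<open>
  The Hahn--Banach theorem for a finitely generated subspace, by induction on the generators. Adding
  a generator \<open>b\<close>, the value \<open>c\<close> of the extended functional at \<open>b\<close> has to lie between all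
  \<open>f y - norm (y - b)\<close> and all \<open>norm (w + b) - f w\<close>, which the triangle inequality allows.
\<close>

lemma norming_functional_on_span:
  fixes z :: "'e::real_normed_vector"
  assumes "finite A"
  shows "\<exists>f :: 'e \<Rightarrow> real. linear f \<and> f z = norm z \<and> (\<forall>x\<in>span (insert z A). f x \<le> norm x)"
  using assms
proof (induction A)
  case empty
  show ?case
  proof (cases "z = 0")
    case True
    then show ?thesis
      by (intro exI[where x = "\<lambda>_. 0"]) (auto simp: module_hom_zero)
  next
    case False
    then have "independent {z}" by simp
    from linear_independent_extend[OF this, of "\<lambda>_. norm z"]
    obtain f :: "'e \<Rightarrow> real" where f: "linear f" "f z = norm z" by auto
    have "f x \<le> norm x" if x_in: "x \<in> span {z}" for x
    proof -
      obtain k where x: "x = k *\<^sub>R z" using x_in by (auto simp: span_singleton)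
      show ?thesis using f by (simp add: x linear_scale mult_right_mono)
    qed
    with f show ?thesis by auto
  qed
next
  case (insert b A)
  then obtain f :: "'e \<Rightarrow> real" where f: "linear f" "f z = norm z"
      and dom: "\<And>x. x \<in> span (insert z A) \<Longrightarrow> f x \<le> norm x"
    by auto
  define V where "V = span (insert z A)"
  have V: "subspace V" by (simp add: V_def)
  have span_b: "span (insert z (insert b A)) = {x. \<exists>k. x - k *\<^sub>R b \<in> V}"
    unfolding V_def by (subst insert_commute) (simp add: span_insert)
  show ?case
  proof (cases "b \<in> V")
    case True
    then have "span (insert z (insert b A)) = V"
      unfolding V_def by (subst insert_commute) (rule span_redundant)
    then show ?thesis using f dom by (auto simp: V_def)
  next
    case False
    obtain B where B: "independent B" "span B = V"
      by (metis V basis_exists span_minimal subset_antisym)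
    have "independent (insert b B)"
      using B False by (simp add: independent_insertI)
    from linear_independent_extend[OF this, of "\<lambda>y. if y = b then 1 else 0"]
    obtain g :: "'e \<Rightarrow> real" where g: "linear g" "g b = 1" "\<forall>y\<in>B. g y = (if y = b then 1 else 0)"
      by auto
    have "b \<notin> B" using B False span_base by blast
    then have gB: "\<And>y. y \<in> B \<Longrightarrow> g y = 0" using g(3) by metis
    have gV: "g y = 0" if "y \<in> V" for y
      using linear_eq_0_on_span[OF g(1) gB] that B(2) by blast
    define c where "c = (SUP y\<in>V. f y - norm (y - b))"
    have sep: "f y - norm (y - b) \<le> norm (w + b) - f w" if "y \<in> V" "w \<in> V" for y w
    proof -
      have "f y + f w \<le> norm (y + w)"
        using dom[of "y + w"] that V f(1) by (simp add: V_def subspace_add linear_add)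
      also have "\<dots> \<le> norm (y - b) + norm (w + b)"
        using norm_triangle_ineq[of "y - b" "w + b"] by simp
      finally show ?thesis by simp
    qed
    have zero: "0 \<in> V" using V by (rule subspace_0)
    have bdd: "bdd_above ((\<lambda>y. f y - norm (y - b)) ` V)"
      using sep[OF _ zero] by (intro bdd_aboveI2) auto
    have c_lower: "f y - norm (y - b) \<le> c" if "y \<in> V" for y
      unfolding c_def using bdd that by (rule cSUP_upper2[OF _ _ order_refl])
    have c_upper: "c \<le> norm (w + b) - f w" if "w \<in> V" for w
      unfolding c_def using zero sep that by (intro cSUP_least) auto
    \<comment> \<open>As \<open>g\<close> vanishes on \<open>V\<close> and \<open>g b = 1\<close>, \<open>h\<close> extends \<open>f\<close> from \<open>V\<close> and takes the value \<open>c\<close> at \<open>b\<close>.\<close>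
    define h where "h x = f x + (c - f b) * g x" for x
    have h: "linear h"
      unfolding h_def using f(1) g(1)
      by (auto simp: linear_iff algebra_simps)
    have "h x \<le> norm x" if x: "x \<in> span (insert z (insert b A))" for x
    proof -
      obtain k where k: "x - k *\<^sub>R b \<in> V" using x span_b by auto
      define y where "y = x - k *\<^sub>R b"
      have y: "y \<in> V" and xy: "x = y + k *\<^sub>R b" using k by (simp_all add: y_def)
      have hx: "h x = f y + k * c"
        using f(1) g y gV by (simp add: h_def xy linear_add linear_scale algebra_simps)
      consider "k = 0" | "k > 0" | "k < 0" by linarith
      then show ?thesis
      proof cases
        case 1
        then show ?thesis using hx xy dom y by (simp add: V_def)
      next
        case 2
        have "k * c \<le> k * (norm ((1 / k) *\<^sub>R y + b) - f ((1 / k) *\<^sub>R y))"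
          using 2 y V by (intro mult_left_mono c_upper subspace_scale) auto
        also have "\<dots> = norm (k *\<^sub>R ((1 / k) *\<^sub>R y + b)) - f y"
          using 2 f(1) by (simp only: norm_scaleR linear_scale) (simp add: right_diff_distrib)
        also have "k *\<^sub>R ((1 / k) *\<^sub>R y + b) = x"
          using 2 by (simp add: xy scaleR_add_right)
        finally show ?thesis using hx by simp
      next
        case 3
        define s where "s = - k"
        have s: "s > 0" using 3 by (simp add: s_def)
        have lower: "s * (f ((1 / s) *\<^sub>R y) - norm ((1 / s) *\<^sub>R y - b)) \<le> s * c"
          using s y V by (intro mult_left_mono c_lower subspace_scale) auto
        have "s * (f ((1 / s) *\<^sub>R y) - norm ((1 / s) *\<^sub>R y - b))
            = f y - norm (s *\<^sub>R ((1 / s) *\<^sub>R y - b))"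
          using s f(1) by (simp only: norm_scaleR linear_scale) (simp add: right_diff_distrib)
        also have "s *\<^sub>R ((1 / s) *\<^sub>R y - b) = x"
          using s by (simp add: xy s_def scaleR_diff_right)
        finally have "f y - norm x \<le> s * c" using lower by (simp only:)
        then show ?thesis using hx by (simp add: s_def)
      qed
    qed
    moreover have "z \<in> V" by (simp add: V_def span_base)
    then have "h z = norm z" using f gV by (simp add: h_def)
    ultimately show ?thesis using h by auto
  qed
qed

lemma countable_dense_in_span:
  fixes A :: "'e::real_normed_vector set"
  assumes "finite A"
  shows "\<exists>D. countable D \<and> D \<subseteq> span A \<and> span A \<subseteq> closure D"
  using assms
proof (induction A)
  case empty
  show ?case by (intro exI[where x = "{0}"]) auto
next
  case (insert b A)
  then obtain D where D: "countable D" "D \<subseteq> span A" "span A \<subseteq> closure D" by auto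
  define D' where "D' = (\<lambda>(y, q). y + q *\<^sub>R b) ` (D \<times> \<rat>)"
  have "countable D'"
    unfolding D'_def using D(1) countable_rat by (intro countable_image countable_SIGMA) auto
  moreover have "D' \<subseteq> span (insert b A)"
    using D(2) span_mono[of A "insert b A"] unfolding D'_def
    by (auto intro!: span_add span_scale simp: span_base)
  moreover have "span (insert b A) \<subseteq> closure D'"
  proof
    fix x assume "x \<in> span (insert b A)"
    then obtain k where k: "x - k *\<^sub>R b \<in> span A" by (auto simp: span_insert)
    have "(x - k *\<^sub>R b, k) \<in> closure (D \<times> \<rat>)"
      using k D(3) by (auto simp: closure_Times Rats_closure_real)
    moreover have "continuous_on (closure (D \<times> \<rat>)) (\<lambda>(y, q::real). y + q *\<^sub>R b)"
      by (auto simp: split_def intro!: continuous_intros)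
    ultimately have "(\<lambda>(y, q). y + q *\<^sub>R b) (x - k *\<^sub>R b, k) \<in> closure D'"
      using image_closure_subset[of "D \<times> \<rat>" "\<lambda>(y, q). y + q *\<^sub>R b" "closure D'"]
      unfolding D'_def by (metis (no_types, lifting) closed_closure closure_subset image_subset_iff)
    then show "x \<in> closure D'" by simp
  qed
  ultimately show ?case by blast
qed

text \<open>
  The \<open>k\<close>-th coordinate of \<open>T x\<close> is a functional that is norming at the \<open>k\<close>-th point of a countable
  dense subset of the span; density gives the norm at all other points of the span.
\<close>

lemma isometric_embedding_of_span:
  fixes A :: "'e::real_normed_vector set"
  assumes A: "finite A"
  shows "\<exists>T :: 'e \<Rightarrow> nat \<Rightarrow>\<^sub>C real. linear T \<and> (\<forall>x\<in>span A. norm (T x) = norm x)"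
proof -
  obtain D where D: "countable D" "D \<subseteq> span A" "span A \<subseteq> closure D"
    using countable_dense_in_span[OF A] by blast
  have "D \<noteq> {}" using D(3) span_zero by fastforce
  then obtain e :: "nat \<Rightarrow> 'e" where e: "range e = D"
    using D(1) by (metis range_from_nat_into)
  have eA: "e k \<in> span A" for k using e D(2) by auto
  have "\<exists>f :: 'e \<Rightarrow> real. linear f \<and> f (e k) = norm (e k) \<and> (\<forall>x\<in>span A. f x \<le> norm x)" for k
    using norming_functional_on_span[OF A, of "e k"] span_redundant[OF eA[of k]] by simp
  then obtain f :: "nat \<Rightarrow> 'e \<Rightarrow> real" where f: "\<And>k. linear (f k)" "\<And>k. f k (e k) = norm (e k)"
      and le: "\<And>k x. x \<in> span A \<Longrightarrow> f k x \<le> norm x"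
    by metis
  have abs_le: "\<bar>f k x\<bar> \<le> norm x" if "x \<in> span A" for k x
    using le[OF that, of k] le[of "- x" k] that f(1)[of k] by (auto simp: span_neg linear_neg abs_le_iff)
  obtain B where B: "independent B" "span B = span A"
    by (metis basis_exists span_minimal subspace_span subset_antisym)
  from linear_independent_extend_subspace[OF B(1), of id]
  obtain P :: "'e \<Rightarrow> 'e" where P: "linear P" "\<And>x. x \<in> B \<Longrightarrow> P x = x" "range P = span A"
    using B(2) by auto
  have P_id: "P x = x" if "x \<in> span A" for x
    using linear_eq_on_span[OF P(1) linear_id, of B x] P(2) that B(2) by simp
  \<comment> \<open>The functionals are bounded by the norm on the span only; composing them with the projection \<open>P\<close>
    makes every sequence bounded, so that \<open>T\<close> is defined and linear on the whole space.\<close>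
  define T where "T x = Bcontfun (\<lambda>k. f k (P x))" for x
  have PA: "P x \<in> span A" for x using P(3) by blast
  have "(\<lambda>k. f k (P x)) \<in> bcontfun" for x
    using abs_le[OF PA] by (intro bcontfun_normI[where b = "norm (P x)"]) auto
  then have T: "apply_bcontfun (T x) k = f k (P x)" for x k
    by (simp add: T_def Bcontfun_inverse)
  have "linear T"
    using f(1) P(1) by (intro linearI bcontfun_eqI) (simp_all add: T linear_add linear_scale)
  moreover have "norm (T x) = norm x" if x: "x \<in> span A" for x
  proof (rule antisym)
    show "norm (T x) \<le> norm x"
      using abs_le[OF x] P_id[OF x] by (intro norm_bound) (simp add: T)
    show "norm x \<le> norm (T x)"
    proof (rule field_le_epsilon)
      fix r :: real assume r: "0 < r"
      have "x \<in> closure D" using x D(3) by blast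
      then obtain y where "y \<in> D" and y: "dist y x < r / 2"
        using r unfolding closure_approachable by (meson half_gt_zero)
      then obtain k where k: "y = e k" using e by blast
      have xy: "y - x \<in> span A" using x eA k by (simp add: span_diff)
      have "f k y - f k x \<le> norm (y - x)"
        using le[OF xy, of k] f(1)[of k] by (simp add: linear_diff)
      moreover have "norm x \<le> norm y + norm (y - x)"
        using norm_triangle_ineq4[of y "y - x"] by simp
      moreover have "f k y = norm y" using f(2) k by simp
      moreover have "f k x \<le> norm (T x)"
        using norm_bounded[of "T x" k] P_id[OF x] by (simp add: T)
      ultimately show "norm x \<le> norm (T x) + r"
        using y by (simp add: dist_norm)
    qed
  qed
  ultimately show ?thesis by blast
qed

section \<open>Reduction to sequence spaces\<close>

lemma sum_scaleR_delta:
  fixes g :: "'i \<Rightarrow> 'v::real_vector"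
  assumes "finite A" and "j \<in> A"
  shows "(\<Sum>l\<in>A. (if l = j then 1 else 0) *\<^sub>R g l) = g j"
  using assms by (simp add: if_distrib[where f = "\<lambda>c. c *\<^sub>R _"] cong: if_cong)

text \<open>
  The moments depend only on the joint law of \<open>X\<close>, which lives on real sequences, and on the norm of
  the span of the finitely many coefficients, which embeds isometrically and linearly into
  \<open>\<ell>\<^sup>\<infinity>\<close>. Hence the inequality passes with the same constant from the coordinate process and the
  embedded coefficients to \<open>X\<close> and the given ones.
\<close>

lemma valid_constant_from_universal:
  assumes univ: "valid_constant_universal d L"
  shows "valid_constant TYPE('a) TYPE('e::real_normed_vector) d L"
  unfolding valid_constant_def
proof (intro allI impI)
  fix n :: nat and a :: "nat \<Rightarrow> nat list \<Rightarrow> 'e" and M :: "'a measure"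
    and X :: "nat \<Rightarrow> 'a \<Rightarrow> real" and p :: real
  assume n: "1 \<le> n" and arrays: "\<forall>j\<le>d. symmetric_array n j (a j) \<and> vanishes_on_diagonals n j (a j)"
    and M: "prob_space M" and indep: "prob_space.indep_vars M (\<lambda>_. borel) X {1..n}"
    and centred: "\<forall>i\<in>{1..n}. integrable M (X i) \<and> (\<integral>\<omega>. X i \<omega> \<partial>M) = 0"
    and p: "1 \<le> p"
  interpret prob_space M by fact
  define I where "I = {1..n}"
  have rv: "X i \<in> borel_measurable M" if "i \<in> I" for i
    using centred that by (auto simp: I_def)
  define A where "A = (\<Union>j\<le>d. a j ` multi_indices n j)"
  have "finite A" by (simp add: A_def finite_multi_indices)
  then obtain T :: "'e \<Rightarrow> nat \<Rightarrow>\<^sub>C real" where T: "linear T" "\<And>x. x \<in> span A \<Longrightarrow> norm (T x) = norm x"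
    using isometric_embedding_of_span by blast
  define b where "b j is = T (a j is)" for j "is"
  have b: "\<forall>j\<le>d. symmetric_array n j (b j) \<and> vanishes_on_diagonals n j (b j)"
    using arrays T(1) by (auto simp: b_def symmetric_array_def vanishes_on_diagonals_def linear_0)

  define x where "x \<omega> i = (if i \<in> I then X i \<omega> else 0)" for \<omega> i
  have x_meas: "x \<in> measurable M (\<Pi>\<^sub>M i\<in>(UNIV :: nat set). borel)"
  proof (intro measurable_PiM_single')
    show "(\<lambda>\<omega>. x \<omega> i) \<in> borel_measurable M" for i
      unfolding x_def using rv by (cases "i \<in> I") auto
  qed auto
  define M' where "M' = distr M (\<Pi>\<^sub>M i\<in>(UNIV :: nat set). borel) x"
  interpret M': prob_space M'
    unfolding M'_def by (rule prob_space_distr[OF x_meas])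
  let ?Y = "\<lambda>i (y :: nat \<Rightarrow> real). y i"
  have Y_meas: "?Y i \<in> borel_measurable M'" for i
    by (simp add: M'_def)
  have law: "distr M' borel (?Y i) = distr M borel (X i)" if "i \<in> I" for i
    unfolding M'_def using x_meas that
    by (subst distr_distr) (auto simp: x_def intro!: distr_cong)
  have "distr M' (\<Pi>\<^sub>M i\<in>I. borel) (\<lambda>y. \<lambda>i\<in>I. y i) = distr M (\<Pi>\<^sub>M i\<in>I. borel) (\<lambda>\<omega>. \<lambda>i\<in>I. X i \<omega>)"
  proof -
    have "(\<lambda>y. \<lambda>i\<in>I. y i) \<in> measurable (\<Pi>\<^sub>M i\<in>(UNIV :: nat set). borel) (\<Pi>\<^sub>M i\<in>I. (borel :: real measure))"
      by (intro measurable_restrict) auto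
    then show ?thesis
      unfolding M'_def using x_meas
      by (subst distr_distr) (auto simp: x_def intro!: distr_cong restrict_ext)
  qed
  also have "\<dots> = (\<Pi>\<^sub>M i\<in>I. distr M borel (X i))"
    using indep n rv by (subst (asm) indep_vars_iff_distr_eq_PiM') (auto simp: I_def)
  also have "\<dots> = (\<Pi>\<^sub>M i\<in>I. distr M' borel (?Y i))"
    using law by (intro PiM_cong) auto
  finally have "M'.indep_vars (\<lambda>_. borel) ?Y I"
    using n Y_meas by (subst M'.indep_vars_iff_distr_eq_PiM') (auto simp: I_def)
  moreover have "integrable M' (?Y i) \<and> (\<integral>y. ?Y i y \<partial>M') = 0" if "i \<in> I" for i
  proof -
    have "(\<lambda>\<omega>. x \<omega> i) = X i" using that by (simp add: x_def fun_eq_iff)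
    then show ?thesis
      using centred that x_meas unfolding M'_def I_def
      by (simp add: integrable_distr_eq integral_distr)
  qed
  ultimately have ineq: "(\<Sum>j\<le>d. Lp_norm M' p (homogeneous_chaos n j (b j) ?Y))
      \<le> ennreal L * Lp_norm M' p (\<lambda>y. \<Sum>j\<le>d. homogeneous_chaos n j (b j) ?Y y)"
    using univ n b p M'.prob_space_axioms unfolding valid_constant_def I_def by blast

  \<comment> \<open>The weights \<open>r\<close> cover at once the whole chaos and, as indicators, its single components.\<close>
  have transfer: "Lp_norm M' p (\<lambda>y. \<Sum>j\<le>d. r j *\<^sub>R homogeneous_chaos n j (b j) ?Y y)
      = Lp_norm M p (\<lambda>\<omega>. \<Sum>j\<le>d. r j *\<^sub>R homogeneous_chaos n j (a j) X \<omega>)" for r :: "nat \<Rightarrow> real"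
  proof -
    let ?F = "\<lambda>y. \<Sum>j\<le>d. r j *\<^sub>R homogeneous_chaos n j (b j) ?Y y"
    have F: "?F = chaos_poly n d (\<lambda>j is. r j *\<^sub>R b j is)"
      by (simp add: fun_eq_iff chaos_poly_def homogeneous_chaos_scaleR_array)
    have "?F \<in> borel_measurable borel"
      unfolding F by (intro borel_measurable_continuous_onI continuous_chaos_poly)
    then have F_meas: "?F \<in> borel_measurable (\<Pi>\<^sub>M i\<in>(UNIV :: nat set). borel)"
      by (simp add: sets_PiM_equal_borel cong: measurable_cong_sets)
    have norm_eq: "norm (?F (x \<omega>)) = norm (\<Sum>j\<le>d. r j *\<^sub>R homogeneous_chaos n j (a j) X \<omega>)" for \<omega>
    proof -
      have "?F (x \<omega>) = (\<Sum>j\<le>d. homogeneous_chaos n j (\<lambda>is. r j *\<^sub>R b j is) X \<omega>)"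
        unfolding fun_cong[OF F] by (rule chaos_poly_eq) (simp add: x_def I_def)
      also have "\<dots> = (\<Sum>j\<le>d. r j *\<^sub>R homogeneous_chaos n j (b j) X \<omega>)"
        by (simp add: homogeneous_chaos_scaleR_array)
      also have "\<dots> = T (\<Sum>j\<le>d. r j *\<^sub>R homogeneous_chaos n j (a j) X \<omega>)"
        using T(1) by (simp add: b_def[abs_def] homogeneous_chaos_linear_image linear_sum linear_scale)
      finally have F_T: "?F (x \<omega>) = T (\<Sum>j\<le>d. r j *\<^sub>R homogeneous_chaos n j (a j) X \<omega>)" .
      have "(\<Sum>j\<le>d. r j *\<^sub>R homogeneous_chaos n j (a j) X \<omega>) \<in> span A"
        unfolding homogeneous_chaos_def
        by (intro span_sum span_scale span_base) (auto simp: A_def)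
      then show ?thesis using F_T T(2) by simp
    qed
    have "(\<integral>\<^sup>+y. ennreal (norm (?F y) powr p) \<partial>M') = (\<integral>\<^sup>+\<omega>. ennreal (norm (?F (x \<omega>)) powr p) \<partial>M)"
    proof -
      have "(\<lambda>y. norm (?F y)) \<in> borel_measurable (\<Pi>\<^sub>M i\<in>(UNIV :: nat set). borel)"
        using F_meas by simp
      then have "(\<lambda>y. ennreal (norm (?F y) powr p)) \<in> borel_measurable (\<Pi>\<^sub>M i\<in>(UNIV :: nat set). borel)"
        by measurable
      then show ?thesis
        unfolding M'_def by (intro nn_integral_distr x_meas) auto
    qed
    then show ?thesis
      unfolding Lp_norm_def by (simp only: norm_eq)
  qed
  have single: "Lp_norm M' p (homogeneous_chaos n j (b j) ?Y) = Lp_norm M p (homogeneous_chaos n j (a j) X)"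
    if "j \<le> d" for j
    using transfer[of "\<lambda>l. if l = j then 1 else 0"] that by (simp add: sum_scaleR_delta)
  show "(\<Sum>j\<le>d. Lp_norm M p (homogeneous_chaos n j (a j) X))
      \<le> ennreal L * Lp_norm M p (\<lambda>\<omega>. \<Sum>j\<le>d. homogeneous_chaos n j (a j) X \<omega>)"
    using ineq transfer[of "\<lambda>_. 1"] by (simp add: single)
qed

theorem proposition1p2:
  fixes d :: nat
  shows "(\<exists>L>0. valid_constant_universal d L) \<and>
         (\<forall>L>0. valid_constant_universal d L \<longrightarrow>
            valid_constant TYPE('a) TYPE('e::real_normed_vector) d L)"
proof (intro conjI allI impI)
  show "\<exists>L>0. valid_constant_universal d L"
    using valid_constant_chaos_const chaos_const_ge_1[of d]
    by (intro exI[where x = "chaos_const d"]) auto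
qed (rule valid_constant_from_universal)

end
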